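(* For an integer $n\geq 9$, Left will win the path position $P_n$ in the Mutual Failures Variant regardless of which player moves first.
   Context: The Mutual Failures Variant of the Mixed Deletion Game is a partisan combinatorial game played on a finite simple undirected graph by two players, Left and Right, who alternate turns. On her turn Left deletes one vertex together with all its incident edges; on his turn Right deletes one edge. A deletion that would create an isolated vertex ends the game and the player who made it loses (so such deletions are effectively unavailable). In addition, the Mutual Failures Variant imposes the condition that in any graph position Right has no available move if and only if Left has no available move. $P_n$ denotes the game position on the path graph with $n$ vertices. *)

theory Defs
  imports Main
begin

record 'a ugraph =
  verts :: "'a set"
  edges :: "'a set set"

definition finite_simple_graph :: "'a ugraph \<Rightarrow> bool" where
  "finite_simple_graph G \<longleftrightarrow>
     finite (verts G) \<and> (\<forall>e\<in>edges G. e \<subseteq> verts G \<and> card e = 2)"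

definition del_vertex :: "'a ugraph \<Rightarrow> 'a \<Rightarrow> 'a ugraph" where
  "del_vertex G v = \<lparr>verts = verts G - {v}, edges = {e \<in> edges G. v \<notin> e}\<rparr>"

definition del_edge :: "'a ugraph \<Rightarrow> 'a set \<Rightarrow> 'a ugraph" where
  "del_edge G e = \<lparr>verts = verts G, edges = edges G - {e}\<rparr>"

definition isolated :: "'a ugraph \<Rightarrow> 'a \<Rightarrow> bool" where
  "isolated G v \<longleftrightarrow> v \<in> verts G \<and> (\<forall>e\<in>edges G. v \<notin> e)"

definition creates_isolated :: "'a ugraph \<Rightarrow> 'a ugraph \<Rightarrow> bool" where
  "creates_isolated G H \<longleftrightarrow> (\<exists>v. isolated H v \<and> \<not> isolated G v)"

datatype player = Left | Right

fun opponent :: "player \<Rightarrow> player" where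
  "opponent Left = Right"
| "opponent Right = Left"

fun deletion :: "player \<Rightarrow> 'a ugraph \<Rightarrow> 'a ugraph \<Rightarrow> bool" where
  "deletion Left G H \<longleftrightarrow> (\<exists>v\<in>verts G. H = del_vertex G v)"
| "deletion Right G H \<longleftrightarrow> (\<exists>e\<in>edges G. H = del_edge G e)"

text \<open>The moves of the Mixed Deletion Game. A deletion that creates an isolated vertex loses at
  once for the player who makes it, so it is not a move; a player without a move loses.\<close>

definition mixed_move :: "player \<Rightarrow> 'a ugraph \<Rightarrow> 'a ugraph \<Rightarrow> bool" where
  "mixed_move p G H \<longleftrightarrow> deletion p G H \<and> \<not> creates_isolated G H"

text \<open>Mutual Failures Variant: as soon as one of the players has no move of the Mixed Deletion
  Game in the position \<open>G\<close>, neither has an available move in \<open>G\<close>. A position is the whole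
  remaining graph, not one of its components.\<close>

definition mf_move :: "player \<Rightarrow> 'a ugraph \<Rightarrow> 'a ugraph \<Rightarrow> bool" where
  "mf_move p G H \<longleftrightarrow> mixed_move p G H \<and> (\<exists>H'. mixed_move (opponent p) G H')"

lemma mutual_failures:
  "(\<nexists>H. mf_move Right G H) \<longleftrightarrow> (\<nexists>H. mf_move Left G H)"
  by (auto simp: mf_move_def)

text \<open>\<open>mf_wins p q G\<close>: player \<open>p\<close> can force a win from \<open>G\<close> when \<open>q\<close> is to move. If the opponent
  is to move and has no available move, the second rule applies vacuously.\<close>

inductive mf_wins :: "player \<Rightarrow> player \<Rightarrow> 'a ugraph \<Rightarrow> bool" for p :: player where
  own_turn: "mf_move p G H \<Longrightarrow> mf_wins p (opponent p) H \<Longrightarrow> mf_wins p p G"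
| opponent_turn:
    "(\<And>H. mf_move (opponent p) G H \<Longrightarrow> mf_wins p p H) \<Longrightarrow> mf_wins p (opponent p) G"

definition path_graph :: "nat \<Rightarrow> nat ugraph" where
  "path_graph n = \<lparr>verts = {..<n}, edges = {{i, Suc i} | i. Suc i < n}\<rparr>"

lemma finite_simple_graph_path_graph: "finite_simple_graph (path_graph n)"
  by (auto simp: finite_simple_graph_def path_graph_def)

lemma finite_simple_graph_mf_move:
  assumes "finite_simple_graph G" and "mf_move p G H"
  shows "finite_simple_graph H"
proof (cases p)
  case Left
  then show ?thesis
    using assms unfolding finite_simple_graph_def mf_move_def mixed_move_def
    by (simp add: del_vertex_def) (elim conjE bexE, simp, blast)
next
  case Right
  then show ?thesis
    using assms unfolding finite_simple_graph_def mf_move_def mixed_move_def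
    by (simp add: del_edge_def) (elim conjE bexE, simp)
qed

end

theory Submission
  imports Defs "HOL-Library.Multiset"
begin

text \<open>A position is a disjoint union of paths, so it is described by the multiset of their numbers
  of vertices, and the game is over when no path has at least four vertices. A path with three
  vertices is a spare move for Left, since Right cannot use it. Left to move therefore wins
  unless the game is over or the position is \<open>P\<^sub>4 + P\<^sub>4\<close> without a spare move: she spends a spare
  move, or shortens a path with at least five vertices, or turns a \<open>P\<^sub>4\<close> into a spare move, and
  only finitely many shapes need another reply. Right to move wins only if he can reach one of
  Left's lost positions, and no \<open>P\<^sub>n\<close> with \<open>n \<ge> 9\<close> is of this kind.\<close>

section \<open>The game on multisets of path lengths\<close>

text \<open>Left deletes an end vertex or an inner vertex of one path. The bounds keep every
  remaining piece at two vertices or more, since a piece with one vertex would be isolated.\<close>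

inductive left_step :: "nat multiset \<Rightarrow> nat multiset \<Rightarrow> bool" where
  shorten: "3 \<le> k \<Longrightarrow> left_step (add_mset k N) (add_mset (k - 1) N)"
| split: "2 \<le> a \<Longrightarrow> 2 \<le> b \<Longrightarrow> left_step (add_mset (Suc (a + b)) N) (add_mset a (add_mset b N))"

inductive right_step :: "nat multiset \<Rightarrow> nat multiset \<Rightarrow> bool" where
  "2 \<le> a \<Longrightarrow> 2 \<le> b \<Longrightarrow> right_step (add_mset (a + b) N) (add_mset a (add_mset b N))"

text \<open>Exactly the paths that Right can cut, as both pieces need two vertices. Once none is
  left, mutual failure stops Left as well, whatever spare moves she has.\<close>

abbreviation live :: "nat multiset \<Rightarrow> nat multiset" where
  "live M \<equiv> filter_mset (\<lambda>k. 4 \<le> k) M"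

text \<open>In P_4 + P_4 without a spare, Left can only turn one P_4 into a P_3; Right then cuts the
  other into 2 + 2 and no live path remains.\<close>

definition lost_left_to_move :: "nat multiset \<Rightarrow> bool" where
  "lost_left_to_move M \<longleftrightarrow> live M = {#} \<or> 3 \<notin># M \<and> live M = {#4, 4#}"

text \<open>One cut leads from here to \<open>lost_left_to_move\<close>. In the first list it leaves
  only pieces 2 and 3. In the second, the cuts 4 = 2 + 2, 6 = 2 + 4 and 8 = 4 + 4 leave P_4 + P_4
  without creating a spare.\<close>

definition lost_right_to_move :: "nat multiset \<Rightarrow> bool" where
  "lost_right_to_move M \<longleftrightarrow> live M \<in> {{#4#}, {#5#}, {#6#}} \<or>
     3 \<notin># M \<and> live M \<in> {{#4, 4, 4#}, {#4, 6#}, {#8#}}"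

lemma add_mset_eqD: "add_mset x A = B \<Longrightarrow> x \<in># B \<and> A = B - {#x#}"
  by auto

lemma live_split:
  assumes "live M = add_mset k L"
  obtains N where "M = add_mset k N" "4 \<le> k" "live N = L"
proof -
  have "k \<in># live M" using assms by simp
  then have "k \<in># M" "4 \<le> k" by auto
  then obtain N where "M = add_mset k N" by (meson multi_member_split)
  with assms \<open>4 \<le> k\<close> show thesis by (intro that[of N]) auto
qed

section \<open>Left's replies\<close>

lemma left_step_shorten: "3 \<le> k \<Longrightarrow> j = k - 1 \<Longrightarrow> left_step (add_mset k N) (add_mset j N)"
  by (hypsubst, rule shorten)

lemma left_step_split:
  "k = Suc (a + b) \<Longrightarrow> 2 \<le> a \<Longrightarrow> 2 \<le> b \<Longrightarrow> left_step (add_mset k N) (add_mset a (add_mset b N))"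
  by (hypsubst, rule split)

text \<open>One deletion breaks the only live path into pieces of at most three vertices, so Right
  has no cut. The largest such path is 7 = 3 + 1 + 3.\<close>

lemma left_reply_single:
  assumes "live M = {#k#}" "k \<in> {4, 5, 6, 7}"
  shows "\<exists>M'. left_step M M' \<and> \<not> lost_right_to_move M'"
proof -
  obtain N where N: "M = add_mset k N" "live N = {#}"
    using assms(1) by (rule live_split)
  consider "k = 4" | "k = 5" | "k = 6" | "k = 7" using assms(2) by auto
  then show ?thesis
  proof cases
    case 1
    then have "left_step M (add_mset 3 N)" unfolding N by (intro left_step_shorten) auto
    then show ?thesis by (intro exI conjI) (auto simp: lost_right_to_move_def N(2))
  next
    case 2
    then have "left_step M (add_mset 2 (add_mset 2 N))" unfolding N by (intro left_step_split) auto
    then show ?thesis by (intro exI conjI) (auto simp: lost_right_to_move_def N(2))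
  next
    case 3
    then have "left_step M (add_mset 2 (add_mset 3 N))" unfolding N by (intro left_step_split) auto
    then show ?thesis by (intro exI conjI) (auto simp: lost_right_to_move_def N(2))
  next
    case 4
    then have "left_step M (add_mset 3 (add_mset 3 N))" unfolding N by (intro left_step_split) auto
    then show ?thesis by (intro exI conjI) (auto simp: lost_right_to_move_def N(2))
  qed
qed

text \<open>Spending the spare leaves the live paths unchanged. Where this fails, a single live path
  of 4 to 6 vertices is destroyed at once; in the other shapes Left keeps the spare, which excludes
  the second list of \<open>lost_right_to_move\<close>, and shortens a live path so as to avoid the
  first.\<close>

lemma left_reply_spare:
  assumes "3 \<in># M" "\<not> lost_left_to_move M"
  shows "\<exists>M'. left_step M M' \<and> \<not> lost_right_to_move M'"
proof -
  obtain N where N: "M = add_mset 3 N" using assms(1) by (meson multi_member_split)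
  have step: "left_step M (add_mset 2 N)" unfolding N by (rule left_step_shorten) auto
  show ?thesis
  proof (cases "lost_right_to_move (add_mset 2 N)")
    case True
    then have "live N \<in> {{#4#}, {#5#}, {#6#}} \<or> live N \<in> {{#4, 4, 4#}, {#4, 6#}, {#8#}}"
      unfolding lost_right_to_move_def by auto
    then consider "live N \<in> {{#4#}, {#5#}, {#6#}}" | "live N = {#4, 4, 4#}" | "live N = {#4, 6#}"
      | "live N = {#8#}"
      by blast
    then show ?thesis
    proof cases
      case 1
      then show ?thesis using N left_reply_single[of M] by auto
    next
      case 2
      then obtain K where K: "N = add_mset 4 K" "live K = {#4, 4#}" by (rule live_split)
      have "left_step M (add_mset 3 (add_mset 3 K))"
        unfolding N K add_mset_commute[of 3 4] by (rule left_step_shorten) auto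
      then show ?thesis by (intro exI conjI) (auto simp: lost_right_to_move_def K(2))
    next
      case 3
      then have "live N = {#6, 4#}" by (simp only: add_mset_commute[of 4 6])
      then obtain K where K: "N = add_mset 6 K" "live K = {#4#}" by (rule live_split)
      \<comment> \<open>Shortening the 4 instead would leave 6 as the only live path, which Right
        wins.\<close>
      have "left_step M (add_mset 5 (add_mset 3 K))"
        unfolding N K add_mset_commute[of 3 6] by (rule left_step_shorten) auto
      then show ?thesis by (intro exI conjI) (auto simp: lost_right_to_move_def K(2))
    next
      case 4
      then obtain K where K: "N = add_mset 8 K" "live K = {#}" by (rule live_split)
      have "left_step M (add_mset 7 (add_mset 3 K))"
        unfolding N K add_mset_commute[of 3 8] by (rule left_step_shorten) auto
      then show ?thesis by (intro exI conjI) (auto simp: lost_right_to_move_def K(2))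
    qed
  qed (use step in blast)
qed

text \<open>Here \<open>j\<close> stands for the path just shortened and \<open>L\<close> for the
  other live paths; the cases are the shapes in which that shortening fails.\<close>

lemma add_mset_critical:
  fixes j :: nat
  assumes "add_mset j L \<in> {{#4#}, {#5#}, {#6#}, {#4, 4, 4#}, {#4, 6#}, {#8#}}"
  shows "j = 4 \<and> L = {#} \<or> j = 5 \<and> L = {#} \<or> j = 6 \<and> L = {#} \<or> j = 4 \<and> L = {#4, 4#} \<or>
    j = 4 \<and> L = {#6#} \<or> j = 6 \<and> L = {#4#} \<or> j = 8 \<and> L = {#}"
  by (insert assms, elim insertE emptyE; drule add_mset_eqD; elim conjE; hypsubst) auto

lemma left_reply_no_spare:
  assumes "3 \<notin># M" "\<not> lost_left_to_move M"
  shows "\<exists>M'. left_step M M' \<and> \<not> lost_right_to_move M'"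
proof (cases "\<exists>k\<in>#M. 5 \<le> k")
  case True
  then obtain k N where k: "M = add_mset k N" "5 \<le> k" by (meson multi_member_split)
  then obtain j where N: "M = add_mset (Suc j) N" and j: "4 \<le> j" by (cases k) auto
  have step: "left_step M (add_mset j N)" unfolding N using j by (intro left_step_shorten) auto
  show ?thesis
  proof (cases "lost_right_to_move (add_mset j N)")
    case True
    then have "add_mset j (live N) \<in> {{#4#}, {#5#}, {#6#}, {#4, 4, 4#}, {#4, 6#}, {#8#}}"
      using j unfolding lost_right_to_move_def by auto
    from add_mset_critical[OF this]
    consider "j \<in> {4, 5, 6}" "live N = {#}" | "j = 4" "live N = {#4, 4#}"
      | "j = 4" "live N = {#6#}" | "j = 6" "live N = {#4#}" | "j = 8" "live N = {#}"
      by blast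
    then show ?thesis
    proof cases
      case 1
      then show ?thesis using N left_reply_single[of M "Suc j"] by auto
    next
      case 2
      \<comment> \<open>P_4 + P_4 without a spare is lost for whoever has to move, so Left hands it
        to Right.\<close>
      have "left_step M (add_mset 2 (add_mset 2 N))"
        unfolding N 2 by (rule left_step_split) auto
      then show ?thesis by (intro exI conjI) (auto simp: lost_right_to_move_def 2(2))
    next
      case 3
      from 3(2) obtain K where K: "N = add_mset 6 K" "live K = {#}" by (rule live_split)
      \<comment> \<open>From 5 + 6 Left moves to 5 + 5, which is in neither list.\<close>
      have "left_step M (add_mset 5 (add_mset (Suc 4) K))"
        unfolding N K 3 add_mset_commute[of "Suc 4" 6] by (intro left_step_shorten) auto
      then show ?thesis by (intro exI conjI) (auto simp: lost_right_to_move_def K(2) add_eq_conv_ex)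
    next
      case 4
      from 4(2) obtain K where K: "N = add_mset 4 K" "live K = {#}" by (rule live_split)
      \<comment> \<open>The 4 becomes a spare, and 7 as the only live path is in neither
        list.\<close>
      have "left_step M (add_mset 3 (add_mset (Suc 6) K))"
        unfolding N K 4 add_mset_commute[of "Suc 6" 4] by (rule left_step_shorten) auto
      then show ?thesis by (intro exI conjI) (auto simp: lost_right_to_move_def K(2))
    next
      case 5
      \<comment> \<open>Deleting the middle vertex of P_9 again hands P_4 + P_4 to Right.\<close>
      have "left_step M (add_mset 4 (add_mset 4 N))"
        unfolding N 5 by (rule left_step_split) auto
      then show ?thesis
        by (intro exI conjI) (auto simp: lost_right_to_move_def 5(2))
    qed
  qed (use step in blast)
next
  case False
  \<comment> \<open>Now every live path is a P_4. Turning one into a spare fails only if exactly one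
    P_4 remains, which is the excluded position P_4 + P_4.\<close>
  obtain k L where "live M = add_mset k L"
    using assms(2) unfolding lost_left_to_move_def by (meson multiset_cases)
  then obtain N where N: "M = add_mset k N" "4 \<le> k" by (rule live_split)
  with False have k: "k = 4" by auto
  have "live N \<noteq> {#4#}" using assms N k by (auto simp: lost_left_to_move_def)
  moreover have "live N \<noteq> {#5#}" "live N \<noteq> {#6#}"
    using False by (auto elim!: live_split simp: N)
  ultimately have "\<not> lost_right_to_move (add_mset 3 N)" by (auto simp: lost_right_to_move_def)
  moreover have "left_step M (add_mset 3 N)" unfolding N k by (rule left_step_shorten) auto
  ultimately show ?thesis by blast
qed

lemma left_reply:
  assumes "\<not> lost_left_to_move M"
  obtains M' where "left_step M M'" "\<not> lost_right_to_move M'"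
  using assms left_reply_spare left_reply_no_spare by blast

section \<open>Right's cuts and termination\<close>

text \<open>The cut is undone: if no live path remains, both pieces are 2 or 3; if P_4 + P_4 without
  a spare remains, both are 2 or 4. Joining them gives the two lists of
  \<open>lost_right_to_move\<close>.\<close>

lemma right_step_not_lost:
  assumes "right_step M M'" "\<not> lost_right_to_move M"
  shows "\<not> lost_left_to_move M'"
  using assms(1)
proof cases
  case (1 a b N)
  show ?thesis
  proof
    assume "lost_left_to_move M'"
    then consider (over) "live M' = {#}" | (fours) "3 \<notin># M'" "live M' = {#4, 4#}"
      unfolding lost_left_to_move_def by blast
    then have "lost_right_to_move M"
    proof cases
      case over
      then have "a \<in> {2, 3}" "b \<in> {2, 3}" "live N = {#}" using 1 by (auto split: if_splits)
      then show ?thesis using 1 by (auto simp: lost_right_to_move_def)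
    next
      case fours
      then have "a = 2 \<or> 4 \<le> a" "b = 2 \<or> 4 \<le> b" using 1 by auto
      moreover have "4 \<le> a \<Longrightarrow> a = 4" "4 \<le> b \<Longrightarrow> b = 4"
        using fours(2) 1 by (auto dest!: add_mset_eqD split: if_splits)
      ultimately have "a \<in> {2, 4}" "b \<in> {2, 4}" by auto
      then show ?thesis using 1 fours
        by (auto simp: lost_right_to_move_def add_mset_commute)
    qed
    with assms(2) show False by contradiction
  qed
qed

text \<open>The number of vertices plus edges, k + (k - 1) for each path; every move lowers
  it.\<close>

definition weight :: "nat multiset \<Rightarrow> nat" where
  "weight M = (\<Sum>k\<in>#M. 2 * k - 1)"

lemma left_step_weight: "left_step M M' \<Longrightarrow> weight M' < weight M"
  by (induction rule: left_step.induct) (auto simp: weight_def)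

lemma right_step_weight: "right_step M M' \<Longrightarrow> weight M' < weight M"
  by (induction rule: right_step.induct) (auto simp: weight_def)

text \<open>Left's move is available in the variant only if Right has one too.\<close>

lemma right_step_exists:
  assumes "\<not> lost_left_to_move M"
  obtains M' where "right_step M M'"
proof -
  obtain k L where "live M = add_mset k L"
    using assms unfolding lost_left_to_move_def by (meson multiset_cases)
  then obtain N where M: "M = add_mset k N" and "4 \<le> k" by (rule live_split)
  then obtain j where k: "k = 2 + j" and j: "2 \<le> j" using le_Suc_ex[of 4 k] by fastforce
  have "right_step M (add_mset 2 (add_mset j N))"
    unfolding M k using j by (intro right_step.intros) auto
  then show thesis by (rule that)
qed

section \<open>Linear forests\<close>

fun path_edges :: "'a list \<Rightarrow> 'a set set" where
  "path_edges (x # y # zs) = insert {x, y} (path_edges (y # zs))"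
| "path_edges _ = {}"

lemma path_edges_append:
  "path_edges (xs @ ys) = path_edges xs \<union> path_edges ys \<union>
     (if xs = [] \<or> ys = [] then {} else {{last xs, hd ys}})"
proof (induction xs rule: path_edges.induct)
  case ("2_2" x)
  then show ?case by (cases ys) auto
qed auto

lemma path_edges_subset: "e \<in> path_edges xs \<Longrightarrow> e \<subseteq> set xs"
  by (induction xs rule: path_edges.induct) auto

lemma path_edges_cover:
  "v \<in> set xs \<Longrightarrow> 2 \<le> length xs \<Longrightarrow> \<exists>e\<in>path_edges xs. v \<in> e"
proof (induction xs rule: path_edges.induct)
  case (1 x y zs)
  then show ?case by (cases zs) auto
qed auto

lemma path_edges_split:
  assumes "e \<in> path_edges xs"
  obtains ys zs where "xs = ys @ zs" "ys \<noteq> []" "zs \<noteq> []" "e = {last ys, hd zs}"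
  using assms
proof (induction xs arbitrary: thesis rule: path_edges.induct)
  case (1 x y zs)
  show ?case
  proof (cases "e = {x, y}")
    case True
    then show ?thesis by (intro "1.prems"(1)[of "[x]" "y # zs"]) auto
  next
    case False
    then have "e \<in> path_edges (y # zs)" using "1.prems"(2) by simp
    then obtain as bs where "y # zs = as @ bs" "as \<noteq> []" "bs \<noteq> []" "e = {last as, hd bs}"
      using "1.IH" by blast
    then show ?thesis by (intro "1.prems"(1)[of "x # as" bs]) auto
  qed
qed auto

text \<open>The equation for \<open>mset_set (verts G)\<close> also says that the lists in \<open>X\<close> are distinct and
  pairwise disjoint. Lists of length at most one are allowed.\<close>

definition linear_forest :: "'a ugraph \<Rightarrow> 'a list multiset \<Rightarrow> bool" where
  "linear_forest G X \<longleftrightarrow> finite (verts G) \<and> mset_set (verts G) = (\<Sum>xs\<in>#X. mset xs) \<and>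
     edges G = (\<Union>xs\<in>set_mset X. path_edges xs)"

lemma mset_set_eq_plusD:
  assumes "mset_set A = B + C"
  shows "set_mset B \<inter> set_mset C = {}"
proof (rule ccontr)
  assume "set_mset B \<inter> set_mset C \<noteq> {}"
  then obtain x where "x \<in># B" "x \<in># C" by auto
  then have "0 < count B x" "0 < count C x" by auto
  then have "2 \<le> count (mset_set A) x" unfolding assms plus_multiset.rep_eq by linarith
  then show False by (simp add: count_mset_set' split: if_splits)
qed

lemma linear_forest_verts: "linear_forest G X \<Longrightarrow> verts G = (\<Union>xs\<in>set_mset X. set xs)"
  unfolding linear_forest_def using finite_set_mset_mset_set[of "verts G"] by auto

text \<open>Each vertex occurs only once among all the lists; hence a deletion inside
  \<open>xs\<close> leaves the edges of the other paths alone.\<close>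

lemma linear_forest_disjoint:
  assumes "linear_forest G (add_mset xs Y)" "e \<in> path_edges ys" "ys \<in># Y"
  shows "e \<inter> set xs = {}"
proof -
  have "set xs \<inter> set_mset (\<Sum>xs\<in>#Y. mset xs) = {}"
    using assms(1) mset_set_eq_plusD[of "verts G" "mset xs" "\<Sum>xs\<in>#Y. mset xs"]
    by (simp add: linear_forest_def)
  then show ?thesis using assms(2,3) path_edges_subset by fastforce
qed

lemma linear_forest_distinct:
  assumes "linear_forest G (add_mset xs Y)"
  shows "distinct xs"
proof -
  have "count (mset xs) x \<le> 1" for x
  proof -
    have "count (mset xs) x \<le> count (mset_set (verts G)) x"
      using assms by (simp add: linear_forest_def)
    also have "\<dots> \<le> 1" by (simp add: count_mset_set')
    finally show ?thesis .
  qed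
  then show ?thesis
    by (metis distinct_count_atmost_1 le_antisym less_one not_le
      not_in_iff set_mset_mset)
qed

lemma linear_forest_drop_Nil: "linear_forest G (add_mset [] Y) \<longleftrightarrow> linear_forest G Y"
  by (simp add: linear_forest_def)

text \<open>An empty \<open>ys\<close> or \<open>zs\<close> covers the deletion of an end vertex;
  \<open>linear_forest_drop_Nil\<close> then discards the empty list.\<close>

lemma linear_forest_del_vertex:
  assumes "linear_forest G (add_mset (ys @ v # zs) Y)"
  shows "linear_forest (del_vertex G v) (add_mset ys (add_mset zs Y))"
proof -
  have v: "v \<notin> set ys" "v \<notin> set zs" using linear_forest_distinct[OF assms] by auto
  have "{e \<in> path_edges (ys @ v # zs). v \<notin> e} = path_edges ys \<union> path_edges zs"
    using v path_edges_append[of ys "v # zs"] path_edges_append[of "[v]" zs]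
    by (auto dest: path_edges_subset split: if_splits)
  moreover have "{e \<in> \<Union>(path_edges ` set_mset Y). v \<notin> e} = \<Union>(path_edges ` set_mset Y)"
    using linear_forest_disjoint[OF assms] by auto
  moreover have "mset_set (verts G - {v}) = mset_set (verts G) - {#v#}"
    using assms by (subst mset_set_Diff) (auto simp: linear_forest_def linear_forest_verts[OF assms])
  ultimately show ?thesis
    using assms unfolding linear_forest_def del_vertex_def
    by (simp add: Collect_disj_eq conj_disj_distribR) blast
qed

text \<open>The deleted edge has one endpoint in each of two disjoint halves, so it is an edge of
  neither.\<close>

lemma linear_forest_del_edge:
  assumes "linear_forest G (add_mset (ys @ zs) Y)" "ys \<noteq> []" "zs \<noteq> []"
  shows "linear_forest (del_edge G {last ys, hd zs}) (add_mset ys (add_mset zs Y))"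
proof -
  let ?e = "{last ys, hd zs}"
  have "set ys \<inter> set zs = {}" using linear_forest_distinct[OF assms(1)] by auto
  moreover have "last ys \<in> set ys" "hd zs \<in> set zs" using assms by auto
  ultimately have "?e \<notin> path_edges ys" "?e \<notin> path_edges zs" by (auto dest: path_edges_subset)
  moreover have "?e \<notin> path_edges xs" if "xs \<in># Y" for xs
    using linear_forest_disjoint[OF assms(1) _ that, of ?e] assms(2) by auto
  ultimately show ?thesis
    using assms unfolding linear_forest_def del_edge_def
    by (auto simp: path_edges_append)
qed

lemma linear_forest_isolated:
  assumes "linear_forest G (add_mset [v] Y)"
  shows "isolated G v"
  using assms linear_forest_verts[OF assms] linear_forest_disjoint[OF assms]
  unfolding isolated_def linear_forest_def by auto

lemma linear_forest_length_neq_1: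
  assumes "linear_forest G (add_mset xs Y)" "\<And>v. \<not> isolated G v"
  shows "length xs \<noteq> 1"
proof
  assume "length xs = 1"
  then obtain v where "xs = [v]" by (auto simp: length_Suc_conv)
  with assms linear_forest_isolated[of G v Y] show False by simp
qed

section \<open>Moves on graphs and steps on multisets\<close>

text \<open>The bound 2 \<le> \<open>k\<close> excludes isolated vertices and empty lists, so a
  deletion that reaches such a graph creates no isolated vertex.\<close>

definition has_path_lengths :: "'a ugraph \<Rightarrow> nat multiset \<Rightarrow> bool" where
  "has_path_lengths G M \<longleftrightarrow>
     (\<exists>X. linear_forest G X \<and> image_mset length X = M) \<and> (\<forall>k\<in>#M. 2 \<le> k)"

lemma has_path_lengths_not_isolated:
  assumes "has_path_lengths G M"
  shows "\<not> isolated G v"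
proof
  assume v: "isolated G v"
  obtain X where X: "linear_forest G X" "\<forall>xs\<in>#X. 2 \<le> length xs"
    using assms unfolding has_path_lengths_def by auto
  have "v \<in> (\<Union>xs\<in>set_mset X. set xs)"
    using v linear_forest_verts[OF X(1)] by (simp add: isolated_def)
  then obtain xs where xs: "xs \<in># X" "v \<in> set xs" by blast
  then obtain e where "e \<in> path_edges xs" "v \<in> e" using X(2) path_edges_cover[OF xs(2)] by blast
  moreover from this(1) have "e \<in> edges G" using X(1) xs(1) by (auto simp: linear_forest_def)
  ultimately show False using v by (auto simp: isolated_def)
qed

lemma has_path_lengths_split:
  assumes "has_path_lengths G (add_mset k N)"
  obtains xs Y where "linear_forest G (add_mset xs Y)" "length xs = k" "image_mset length Y = N"
  using assms unfolding has_path_lengths_def by (metis msed_map_invR)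

lemma mixed_moveI:
  assumes "deletion p G H" "has_path_lengths H M"
  shows "mixed_move p G H"
  using assms(1) has_path_lengths_not_isolated[OF assms(2)]
  by (simp add: mixed_move_def creates_isolated_def)

text \<open>Realizes on the graph the reply that Left chooses on multisets.\<close>

lemma mixed_move_left_step:
  assumes "has_path_lengths G M" "left_step M M'"
  obtains H where "mixed_move Left G H" "has_path_lengths H M'"
proof -
  from assms(2) show thesis
  proof cases
    case (shorten k N)
    from assms(1) obtain xs Y where X: "linear_forest G (add_mset xs Y)" "length xs = k"
      "image_mset length Y = N" unfolding shorten by (rule has_path_lengths_split)
    then obtain v zs where xs: "xs = v # zs" using shorten by (cases xs) auto
    have "linear_forest (del_vertex G v) (add_mset zs Y)"
      using X linear_forest_del_vertex[of G "[]" v zs Y] unfolding xs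
      by (simp add: linear_forest_drop_Nil)
    then have "has_path_lengths (del_vertex G v) M'"
      using assms(1) X xs shorten by (auto simp: has_path_lengths_def)
    moreover have "deletion Left G (del_vertex G v)"
      using xs linear_forest_verts[OF X(1)] by auto
    ultimately show thesis using mixed_moveI that by blast
  next
    case (split a b N)
    from assms(1) obtain xs Y where X: "linear_forest G (add_mset xs Y)" "length xs = Suc (a + b)"
      "image_mset length Y = N" unfolding split by (rule has_path_lengths_split)
    define ys v zs where "ys = take a xs" and "v = xs ! a" and "zs = drop (Suc a) xs"
    have xs: "xs = ys @ v # zs" "length ys = a" "length zs = b"
      using X(2) by (auto simp: ys_def v_def zs_def id_take_nth_drop)
    have "linear_forest (del_vertex G v) (add_mset ys (add_mset zs Y))"
      using X linear_forest_del_vertex[of G ys v zs Y] unfolding xs by simp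
    then have "has_path_lengths (del_vertex G v) M'"
      using assms(1) X xs split by (auto simp: has_path_lengths_def)
    moreover have "deletion Left G (del_vertex G v)"
      using xs(1) linear_forest_verts[OF X(1)] by auto
    ultimately show thesis using mixed_moveI that by blast
  qed
qed

text \<open>Left must answer every move of Right, so each has to appear as a step. A piece with one
  vertex would be isolated.\<close>

lemma right_step_of_mixed_move:
  assumes "has_path_lengths G M" "mixed_move Right G H"
  obtains M' where "right_step M M'" "has_path_lengths H M'"
proof -
  \<comment> \<open>As \<open>G\<close> has no isolated vertex, any isolated vertex of
    \<open>H\<close> would have been created by the cut.\<close>
  obtain e where e: "e \<in> edges G" "H = del_edge G e" and iso: "\<not> isolated H v" for v
    using assms(2) has_path_lengths_not_isolated[OF assms(1)]
    by (auto simp: mixed_move_def creates_isolated_def)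
  obtain X where X: "linear_forest G X" "image_mset length X = M"
    using assms(1) unfolding has_path_lengths_def by blast
  obtain xs where "xs \<in># X" "e \<in> path_edges xs"
    using X(1) e(1) by (auto simp: linear_forest_def)
  then obtain Y ys zs where Y: "X = add_mset (ys @ zs) Y" and ne: "ys \<noteq> []" "zs \<noteq> []"
    and e': "e = {last ys, hd zs}" by (metis path_edges_split multi_member_split)
  have H: "linear_forest H (add_mset ys (add_mset zs Y))"
    using X(1) ne unfolding Y e e' by (rule linear_forest_del_edge)
  then have H': "linear_forest H (add_mset zs (add_mset ys Y))" by (simp add: add_mset_commute)
  have "length ys \<noteq> 1" using H iso by (rule linear_forest_length_neq_1)
  moreover have "length zs \<noteq> 1" using H' iso by (rule linear_forest_length_neq_1)
  ultimately have len: "2 \<le> length ys" "2 \<le> length zs"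
    using ne by (simp_all add: Suc_le_eq numeral_2_eq_2 nat_neq_iff)
  show thesis
  proof
    show "right_step M (add_mset (length ys) (add_mset (length zs) (image_mset length Y)))"
      using right_step.intros[OF len] X(2) Y by auto
    show "has_path_lengths H (add_mset (length ys) (add_mset (length zs) (image_mset length Y)))"
      using H len assms(1) X(2) Y unfolding has_path_lengths_def
      by (intro conjI exI[of _ "add_mset ys (add_mset zs Y)"]) auto
  qed
qed

text \<open>Turns the cut from \<open>right_step_exists\<close> into a move on the graph, which
  certifies that Left's moves are available.\<close>

lemma mixed_move_of_right_step:
  assumes "has_path_lengths G M" "right_step M M'"
  obtains H where "mixed_move Right G H"
  using assms(2)
proof cases
  case (1 a b N)
  from assms(1) obtain xs Y where X: "linear_forest G (add_mset xs Y)" "length xs = a + b"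
    "image_mset length Y = N" unfolding 1 by (rule has_path_lengths_split)
  define ys zs where "ys = take a xs" and "zs = drop a xs"
  have xs: "xs = ys @ zs" "length ys = a" "length zs = b" using X(2) by (auto simp: ys_def zs_def)
  then have ne: "ys \<noteq> []" "zs \<noteq> []" using 1 by auto
  let ?e = "{last ys, hd zs}"
  have "linear_forest (del_edge G ?e) (add_mset ys (add_mset zs Y))"
    using X(1) ne unfolding xs by (rule linear_forest_del_edge)
  then have "has_path_lengths (del_edge G ?e) M'"
    using assms(1) X xs 1 by (auto simp: has_path_lengths_def)
  moreover have "deletion Right G (del_edge G ?e)"
    using X(1) ne unfolding xs by (auto simp: linear_forest_def path_edges_append)
  ultimately show thesis using mixed_moveI that by blast
qed

text \<open>Both claims go through one induction on \<open>weight\<close>, since each move passes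
  from one to the other.\<close>

lemma mf_wins_left:
  assumes "has_path_lengths G M"
  shows "(\<not> lost_left_to_move M \<longrightarrow> mf_wins Left Left G) \<and>
    (\<not> lost_right_to_move M \<longrightarrow> mf_wins Left Right G)"
  using assms
proof (induction "weight M" arbitrary: G M rule: less_induct)
  case less
  show ?case
  proof (intro conjI impI)
    assume M: "\<not> lost_left_to_move M"
    obtain M' where M': "left_step M M'" "\<not> lost_right_to_move M'" using M by (rule left_reply)
    obtain H where H: "mixed_move Left G H" "has_path_lengths H M'"
      using less.prems M'(1) by (rule mixed_move_left_step)
    obtain N where "right_step M N" using M by (rule right_step_exists)
    then obtain H' where "mixed_move Right G H'" using less.prems mixed_move_of_right_step by blast
    with H(1) have "mf_move Left G H" by (auto simp: mf_move_def)
    moreover have "mf_wins Left (opponent Left) H"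
      using less.hyps[OF left_step_weight[OF M'(1)] H(2)] M'(2) by simp
    ultimately show "mf_wins Left Left G" by (rule own_turn)
  next
    assume M: "\<not> lost_right_to_move M"
    \<comment> \<open>If Right has no available move, this holds vacuously and Left has won.\<close>
    have "mf_wins Left Left H" if "mf_move (opponent Left) G H" for H
    proof -
      have "mixed_move Right G H" using that by (simp add: mf_move_def)
      with less.prems obtain M' where "right_step M M'" "has_path_lengths H M'"
        by (rule right_step_of_mixed_move)
      then show ?thesis using less.hyps right_step_weight right_step_not_lost M by blast
    qed
    then have "mf_wins Left (opponent Left) G" by (rule opponent_turn)
    then show "mf_wins Left Right G" by simp
  qed
qed

section \<open>The path graph as a linear forest\<close>

lemma path_edges_upt: "path_edges [0..<n] = (\<lambda>i. {i, Suc i}) ` {..<n - 1}"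
proof (induction n)
  case (Suc n)
  have "path_edges [0..<Suc n] = path_edges [0..<n] \<union> (if n = 0 then {} else {{n - 1, n}})"
    using path_edges_append[of "[0..<n]" "[n]"] by (simp add: last_upt)
  then show ?case unfolding Suc by (cases n) (simp_all add: lessThan_Suc)
qed simp

lemma linear_forest_path_graph: "linear_forest (path_graph n) {#[0..<n]#}"
proof -
  have "{i. Suc i < n} = {..<n - 1}" by auto
  then have "edges (path_graph n) = path_edges [0..<n]"
    by (simp add: path_graph_def path_edges_upt setcompr_eq_image)
  then show ?thesis
    by (simp add: linear_forest_def path_graph_def atLeast0LessThan)
qed

lemma has_path_lengths_path_graph:
  assumes "2 \<le> n"
  shows "has_path_lengths (path_graph n) {#n#}"
  unfolding has_path_lengths_def
proof
  show "\<exists>X. linear_forest (path_graph n) X \<and> image_mset length X = {#n#}"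
    using linear_forest_path_graph by (intro exI conjI) auto
qed (use assms in simp)

theorem theorem3p18:
  fixes n :: nat
  assumes "n \<ge> 9"
  shows "\<forall>first. mf_wins Left first (path_graph n)"
proof
  fix first
  have "has_path_lengths (path_graph n) {#n#}"
    using assms by (intro has_path_lengths_path_graph) simp
  moreover have "\<not> lost_left_to_move {#n#}" "\<not> lost_right_to_move {#n#}"
    using assms by (auto simp: lost_left_to_move_def lost_right_to_move_def dest: add_mset_eqD)
  ultimately show "mf_wins Left first (path_graph n)" using mf_wins_left by (cases first) auto
qed

end
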